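(* Let $G$ be a strongly topological gyrogroup and let $H$ be a locally compact strong subgyrogroup of $G$. Then there exists an open neighborhood $U$ of the identity element $0$ such that $\pi(\overline U)$ is closed in $G/H$ and the restriction of $\pi$ to $\overline U$ is a perfect mapping from $\overline U$ onto the subspace $\pi(\overline U)$ of $G/H$.
   Context: All topological spaces are assumed Hausdorff. A gyrogroup is a nonempty set $G$ with a binary operation $\oplus$ such that: (G1) there is a unique $0\in G$ with $0\oplus a=a=a\oplus 0$ for all $a$; (G2) each $x\in G$ has a unique inverse $\ominus x$ with $\ominus x\oplus x=0=x\oplus(\ominus x)$; (G3) for all $x,y\in G$ there is an automorphism $\mathrm{gyr}[x,y]$ of $(G,\oplus)$ with $x\oplus(y\oplus z)=(x\oplus y)\oplus\mathrm{gyr}[x,y](z)$ for all $z\in G$; (G4) $\mathrm{gyr}[x\oplus y,y]=\mathrm{gyr}[x,y]$ for all $x,y\in G$. A topological gyrogroup is a gyrogroup with a topology making $\oplus:G\times G\to G$ jointly continuous and $x\mapsto\ominus x$ continuous. It is a strongly topological gyrogroup if there is a neighborhood base $\mathscr U$ of $0$ with $\mathrm{gyr}[x,y](U)=U$ for all $U\in\mathscr U$ and $x,y\in G$. A subgyrogroup is a nonempty subset $H\subseteq G$ that is a gyrogroup under the inherited operation and such that $\mathrm{gyr}[a,b]$ restricts to an automorphism of $H$ for all $a,b\in H$. It is a strong subgyrogroup if $\mathrm{gyr}[x,y](H)=H$ for all $x,y\in G$. For such $H$ the left cosets $a\oplus H$ ($a\in G$) partition $G$; $G/H=\{a\oplus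 H:a\in G\}$ carries the quotient topology induced by $\pi:G\to G/H$, $\pi(a)=a\oplus H$. Subgyrogroups carry the subspace topology. A perfect mapping is a continuous closed surjection with compact fibers. *)

theory Defs
  imports "HOL-Analysis.Analysis"
begin

definition gyro_automorphism :: "'a set \<Rightarrow> ('a \<Rightarrow> 'a \<Rightarrow> 'a) \<Rightarrow> ('a \<Rightarrow> 'a) \<Rightarrow> bool" where
  "gyro_automorphism G add f \<longleftrightarrow>
     bij_betw f G G \<and> (\<forall>x\<in>G. \<forall>y\<in>G. f (add x y) = add (f x) (f y))"

text \<open>
  Gyrogroups on a carrier set \<open>G\<close>. The identity, the inversion and the gyrations are parameters;
  on \<open>G\<close> they are determined by the operation. Their values outside \<open>G\<close> are irrelevant.
\<close>

locale gyrogroup =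
  fixes G :: "'a set"
    and add :: "'a \<Rightarrow> 'a \<Rightarrow> 'a"  (infixl "\<oplus>" 65)
    and zero :: 'a
    and neg :: "'a \<Rightarrow> 'a"
    and gyr :: "'a \<Rightarrow> 'a \<Rightarrow> 'a \<Rightarrow> 'a"
  assumes add_closed: "\<lbrakk>x \<in> G; y \<in> G\<rbrakk> \<Longrightarrow> x \<oplus> y \<in> G"
    and zero_closed: "zero \<in> G"
    and zero_add: "x \<in> G \<Longrightarrow> zero \<oplus> x = x"
    and add_zero: "x \<in> G \<Longrightarrow> x \<oplus> zero = x"
    and zero_unique: "\<lbrakk>e \<in> G; \<And>x. x \<in> G \<Longrightarrow> e \<oplus> x = x \<and> x \<oplus> e = x\<rbrakk> \<Longrightarrow> e = zero"
    and neg_closed: "x \<in> G \<Longrightarrow> neg x \<in> G"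
    and neg_add: "x \<in> G \<Longrightarrow> neg x \<oplus> x = zero"
    and add_neg: "x \<in> G \<Longrightarrow> x \<oplus> neg x = zero"
    and neg_unique: "\<lbrakk>x \<in> G; y \<in> G; y \<oplus> x = zero; x \<oplus> y = zero\<rbrakk> \<Longrightarrow> y = neg x"
    and gyr_automorphism: "\<lbrakk>x \<in> G; y \<in> G\<rbrakk> \<Longrightarrow> gyro_automorphism G add (gyr x y)"
    and gyr_assoc: "\<lbrakk>x \<in> G; y \<in> G; z \<in> G\<rbrakk> \<Longrightarrow> x \<oplus> (y \<oplus> z) = (x \<oplus> y) \<oplus> gyr x y z"
    and gyr_loop: "\<lbrakk>x \<in> G; y \<in> G; z \<in> G\<rbrakk> \<Longrightarrow> gyr (x \<oplus> y) y z = gyr x y z"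

locale topological_gyrogroup =
  gyrogroup "topspace T" add zero neg gyr
  for T :: "'a topology" and add zero neg gyr +
  assumes continuous_add: "continuous_map (prod_topology T T) T (\<lambda>(x, y). add x y)"
    and continuous_neg: "continuous_map T T neg"

text \<open>Neighbourhoods, and hence members of the base, need not be open.\<close>

locale strongly_topological_gyrogroup =
  topological_gyrogroup T add zero neg gyr
  for T :: "'a topology" and add zero neg gyr +
  assumes invariant_base:
    "\<exists>\<U>. (\<forall>U\<in>\<U>. U \<subseteq> topspace T \<and> (\<exists>V. openin T V \<and> zero \<in> V \<and> V \<subseteq> U)) \<and>
         (\<forall>W. openin T W \<and> zero \<in> W \<longrightarrow> (\<exists>U\<in>\<U>. U \<subseteq> W)) \<and>
         (\<forall>U\<in>\<U>. \<forall>x\<in>topspace T. \<forall>y\<in>topspace T. gyr x y ` U = U)"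

definition subgyrogroup ::
  "'a set \<Rightarrow> ('a \<Rightarrow> 'a \<Rightarrow> 'a) \<Rightarrow> ('a \<Rightarrow> 'a \<Rightarrow> 'a \<Rightarrow> 'a) \<Rightarrow> 'a set \<Rightarrow> bool" where
  "subgyrogroup G add gyr H \<longleftrightarrow>
     H \<noteq> {} \<and> H \<subseteq> G \<and>
     (\<exists>zero' neg' gyr'. gyrogroup H add zero' neg' gyr') \<and>
     (\<forall>a\<in>H. \<forall>b\<in>H. gyro_automorphism H add (gyr a b))"

definition strong_subgyrogroup ::
  "'a set \<Rightarrow> ('a \<Rightarrow> 'a \<Rightarrow> 'a) \<Rightarrow> ('a \<Rightarrow> 'a \<Rightarrow> 'a \<Rightarrow> 'a) \<Rightarrow> 'a set \<Rightarrow> bool" where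
  "strong_subgyrogroup G add gyr H \<longleftrightarrow>
     subgyrogroup G add gyr H \<and> (\<forall>x\<in>G. \<forall>y\<in>G. gyr x y ` H = H)"

definition left_coset :: "('a \<Rightarrow> 'a \<Rightarrow> 'a) \<Rightarrow> 'a set \<Rightarrow> 'a \<Rightarrow> 'a set" where
  "left_coset add H a = add a ` H"

text \<open>The space \<open>G/H\<close>; the projection onto it is \<^term>\<open>left_coset add H\<close>.\<close>

definition coset_space :: "'a topology \<Rightarrow> ('a \<Rightarrow> 'a \<Rightarrow> 'a) \<Rightarrow> 'a set \<Rightarrow> 'a set topology" where
  "coset_space T add H =
     topology (\<lambda>W. W \<subseteq> left_coset add H ` topspace T \<and>
                   openin T {x \<in> topspace T. left_coset add H x \<in> W})"

lemma openin_coset_space: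
  "openin (coset_space T add H) W \<longleftrightarrow>
     W \<subseteq> left_coset add H ` topspace T \<and>
     openin T {x \<in> topspace T. left_coset add H x \<in> W}"
proof -
  let ?p = "left_coset add H"
  let ?P = "\<lambda>W. W \<subseteq> ?p ` topspace T \<and> openin T {x \<in> topspace T. ?p x \<in> W}"
  have "istopology ?P"
    unfolding istopology_def
  proof (intro conjI allI impI)
    fix S S' assume a: "?P S" "?P S'"
    then show "S \<inter> S' \<subseteq> ?p ` topspace T" by blast
    have "{x \<in> topspace T. ?p x \<in> S \<inter> S'} =
        {x \<in> topspace T. ?p x \<in> S} \<inter> {x \<in> topspace T. ?p x \<in> S'}" by blast
    with a show "openin T {x \<in> topspace T. ?p x \<in> S \<inter> S'}" by (simp add: openin_Int)
  next
    fix \<K> assume a: "\<forall>K\<in>\<K>. ?P K"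
    then show "\<Union>\<K> \<subseteq> ?p ` topspace T" by blast
    have "{x \<in> topspace T. ?p x \<in> \<Union>\<K>} = (\<Union>K\<in>\<K>. {x \<in> topspace T. ?p x \<in> K})" by blast
    with a show "openin T {x \<in> topspace T. ?p x \<in> \<Union>\<K>}" by auto
  qed
  then show ?thesis
    by (simp add: coset_space_def topology_inverse')
qed

lemma topspace_coset_space: "topspace (coset_space T add H) = left_coset add H ` topspace T"
proof
  show "topspace (coset_space T add H) \<subseteq> left_coset add H ` topspace T"
    by (metis openin_coset_space openin_topspace)
  have "{x \<in> topspace T. left_coset add H x \<in> left_coset add H ` topspace T} = topspace T"
    by blast
  then have "openin (coset_space T add H) (left_coset add H ` topspace T)"
    by (simp add: openin_coset_space)
  then show "left_coset add H ` topspace T \<subseteq> topspace (coset_space T add H)"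
    by (rule openin_subset)
qed

lemma quotient_map_left_coset: "quotient_map T (coset_space T add H) (left_coset add H)"
  by (auto simp: quotient_map_def topspace_coset_space openin_coset_space)

end

theory Submission
  imports Defs
begin

text \<open>
  The equation \<open>w \<oplus> z = x\<close> is solved by \<open>w = x \<oplus> (\<ominus>(x \<oplus> z) \<oplus> x)\<close>, which is continuous in \<open>z\<close> and
  vanishes at \<open>z = x\<close>. Hence \<open>W \<oplus> x\<close> is a neighbourhood of \<open>x\<close> for every neighbourhood \<open>W\<close> of \<open>0\<close>.
  Let \<open>V\<close> be an open neighbourhood of \<open>0\<close> with \<open>V \<inter> H\<close> inside a compact \<open>K \<subseteq> H\<close>, let \<open>N\<close> be one with
  \<open>\<ominus>N \<oplus> N \<subseteq> V\<close>, and let \<open>U\<close> be one with \<open>U \<oplus> (U \<oplus> U) \<subseteq> N\<close>, so that \<open>U \<oplus> cl U \<subseteq> N\<close>.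
  For \<open>F \<subseteq> cl U\<close> closed, the closure of \<open>F \<oplus> H\<close> lies in \<open>N \<oplus> H\<close>. Inside \<open>N\<close>, the set \<open>F \<oplus> H\<close>
  coincides with the projection along \<open>K\<close> of the closed set of all \<open>(y, k)\<close> with \<open>y \<oplus> k \<in> F\<close>,
  which is closed because \<open>K\<close> is compact. So \<open>F \<oplus> H\<close> is closed, and the fibre of \<open>\<pi>\<close> over
  \<open>a \<oplus> H\<close> in \<open>cl U\<close> is the compact set \<open>(a \<oplus> K) \<inter> cl U\<close>.
\<close>

section \<open>Cancellation laws and gyration identities\<close>

context gyrogroup
begin

lemma gyr_closed: "\<lbrakk>x \<in> G; y \<in> G; z \<in> G\<rbrakk> \<Longrightarrow> gyr x y z \<in> G"
  using gyr_automorphism[of x y] unfolding gyro_automorphism_def by (meson bij_betwE)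

lemma gyr_add: "\<lbrakk>x \<in> G; y \<in> G; a \<in> G; b \<in> G\<rbrakk> \<Longrightarrow> gyr x y (a \<oplus> b) = gyr x y a \<oplus> gyr x y b"
  using gyr_automorphism[of x y] unfolding gyro_automorphism_def by blast

text \<open>Adding \<open>neg a\<close> on the left turns \<open>a \<oplus> b\<close> into
  \<open>gyr (neg a) a b\<close>, and a gyration is injective.\<close>

lemma add_left_inj:
  assumes "a \<in> G" "b \<in> G" "c \<in> G" "a \<oplus> b = a \<oplus> c"
  shows "b = c"
proof -
  have "gyr (neg a) a b = neg a \<oplus> (a \<oplus> b)" "gyr (neg a) a c = neg a \<oplus> (a \<oplus> c)"
    using gyr_assoc[of "neg a" a b] gyr_assoc[of "neg a" a c] assms(1-3)
    by (simp_all only: neg_closed neg_add zero_add gyr_closed)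
  moreover have "inj_on (gyr (neg a) a) G"
    using gyr_automorphism[of "neg a" a] assms(1) neg_closed
    unfolding gyro_automorphism_def by (blast intro: bij_betw_imp_inj_on)
  ultimately show ?thesis
    using assms by (metis inj_onD)
qed

lemma gyr_zero_left:
  assumes "y \<in> G" "z \<in> G"
  shows "gyr zero y z = z"
proof -
  have "y \<oplus> gyr zero y z = y \<oplus> z"
    using gyr_assoc[of zero y z] assms by (simp add: zero_closed zero_add add_closed)
  with assms show ?thesis
    by (meson add_left_inj gyr_closed zero_closed)
qed

text \<open>The loop property at the pair \<open>neg y\<close>, \<open>y\<close> reduces this
  gyration to \<open>gyr zero y\<close>, which is the identity.\<close>

lemma gyr_neg_left:
  assumes "y \<in> G" "z \<in> G"
  shows "gyr (neg y) y z = z"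
  using gyr_loop[OF neg_closed assms(1) assms(2), of y] assms
  by (simp only: neg_add gyr_zero_left)

lemma gyr_self:
  assumes "y \<in> G" "z \<in> G"
  shows "gyr y y z = z"
  using gyr_loop[OF zero_closed assms] assms by (simp only: zero_add gyr_zero_left)

lemma left_cancel:
  assumes "a \<in> G" "b \<in> G"
  shows "neg a \<oplus> (a \<oplus> b) = b"
  using gyr_assoc[OF neg_closed assms(1) assms(2), of a] assms
  by (simp only: neg_add gyr_neg_left zero_add)

lemma neg_neg:
  assumes "a \<in> G"
  shows "neg (neg a) = a"
  using neg_unique[OF neg_closed[OF assms] assms add_neg[OF assms] neg_add[OF assms]] by simp

lemma left_cancel':
  assumes "a \<in> G" "b \<in> G"
  shows "a \<oplus> (neg a \<oplus> b) = b"
  using left_cancel[OF neg_closed[OF assms(1)] assms(2)] neg_neg[OF assms(1)] by simp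

lemma gyr_zero:
  assumes "x \<in> G" "y \<in> G"
  shows "gyr x y zero = zero"
proof (rule add_left_inj)
  show G: "gyr x y zero \<in> G" by (rule gyr_closed[OF assms zero_closed])
  then show "gyr x y zero \<oplus> gyr x y zero = gyr x y zero \<oplus> zero"
    using gyr_add[OF assms zero_closed zero_closed] zero_add[OF zero_closed] add_zero[OF G] by simp
qed (simp_all add: gyr_closed assms zero_closed)

lemma add_gyr_neg:
  assumes "x \<in> G" "y \<in> G"
  shows "(x \<oplus> y) \<oplus> gyr x y (neg y) = x"
  using gyr_assoc[OF assms neg_closed[OF assms(2)]] assms by (simp only: add_neg add_zero)

text \<open>Cancel \<open>x \<oplus> y\<close> in \<open>add_gyr_neg\<close>. The right side uses
  only addition and inversion, so its continuity in \<open>y\<close> is visible.\<close>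

lemma gyr_neg_right:
  assumes "x \<in> G" "y \<in> G"
  shows "gyr x y (neg y) = neg (x \<oplus> y) \<oplus> x"
  using left_cancel[OF add_closed[OF assms] gyr_closed[OF assms neg_closed[OF assms(2)]]]
    add_gyr_neg[OF assms] by simp

text \<open>Expand \<open>a \<oplus> c = a \<oplus> (b \<oplus> (neg b \<oplus> c))\<close> by two
  uses of gyroassociativity and cancel \<open>a\<close>. This undoes \<open>gyr a b\<close> by
  another gyration with the same first argument.\<close>

lemma gyr_gyr_neg:
  assumes "a \<in> G" "b \<in> G" "c \<in> G"
  shows "gyr a (gyr a b (neg b)) (gyr a b c) = c"
proof -
  define w where "w = gyr a b (neg b)"
  have G: "w \<in> G" "gyr a b c \<in> G" "a \<oplus> b \<in> G" "neg b \<in> G" "neg b \<oplus> c \<in> G"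
    unfolding w_def using assms by (simp_all add: gyr_closed neg_closed add_closed)
  have "a \<oplus> c = a \<oplus> (b \<oplus> (neg b \<oplus> c))"
    using assms by (simp add: left_cancel')
  also have "\<dots> = (a \<oplus> b) \<oplus> gyr a b (neg b \<oplus> c)"
    using assms G by (intro gyr_assoc)
  also have "\<dots> = (a \<oplus> b) \<oplus> (w \<oplus> gyr a b c)"
    unfolding w_def using assms G by (simp add: gyr_add)
  also have "\<dots> = ((a \<oplus> b) \<oplus> w) \<oplus> gyr (a \<oplus> b) w (gyr a b c)"
    using G by (intro gyr_assoc)
  also have "(a \<oplus> b) \<oplus> w = a"
    unfolding w_def using assms by (simp add: add_gyr_neg)
  \<comment> \<open>Because \<open>(a \<oplus> b) \<oplus> w = a\<close>, the loop property replaces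
    the first argument \<open>a \<oplus> b\<close> by \<open>a\<close>.\<close>
  also have "gyr (a \<oplus> b) w (gyr a b c) = gyr a w (gyr a b c)"
    using gyr_loop[of "a \<oplus> b" w "gyr a b c"] G \<open>(a \<oplus> b) \<oplus> w = a\<close> by simp
  finally have "a \<oplus> c = a \<oplus> gyr a w (gyr a b c)" .
  with assms G show ?thesis
    unfolding w_def by (metis add_left_inj gyr_closed)
qed

text \<open>Writing \<open>z\<close> as \<open>gyr x w (gyr x z z)\<close> allows regrouping to
  \<open>x \<oplus> (w \<oplus> gyr x z z)\<close>, whose inner sum is the image of
  \<open>neg z \<oplus> z\<close> under \<open>gyr x z\<close>.\<close>

lemma right_cancel:
  assumes "x \<in> G" "z \<in> G"
  shows "(x \<oplus> (neg (x \<oplus> z) \<oplus> x)) \<oplus> z = x"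
proof -
  define w where "w = gyr x z (neg z)"
  have G: "w \<in> G" "gyr x z z \<in> G"
    unfolding w_def using assms by (simp_all add: gyr_closed neg_closed)
  have "(x \<oplus> w) \<oplus> z = (x \<oplus> w) \<oplus> gyr x w (gyr x z z)"
    unfolding w_def using assms by (simp add: gyr_gyr_neg)
  also have "\<dots> = x \<oplus> (w \<oplus> gyr x z z)"
    using assms G by (simp add: gyr_assoc)
  also have "w \<oplus> gyr x z z = gyr x z (neg z \<oplus> z)"
    unfolding w_def using assms by (simp add: gyr_add neg_closed)
  also have "\<dots> = zero"
    using assms by (simp add: neg_add gyr_zero)
  finally show ?thesis
    unfolding w_def gyr_neg_right[OF assms] add_zero[OF assms(1)] .
qed

text \<open>Since \<open>gyr x x\<close> is the identity, the left side is
  \<open>x \<oplus> neg x\<close>.\<close>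

lemma right_cancel_self:
  assumes "x \<in> G"
  shows "x \<oplus> (neg (x \<oplus> x) \<oplus> x) = zero"
  unfolding gyr_neg_right[OF assms assms, symmetric]
  using assms by (simp add: gyr_self neg_closed add_neg)

section \<open>Left cosets of a strong subgyrogroup\<close>

context
  fixes H
  assumes strong: "strong_subgyrogroup G add gyr H"
begin

lemma strong_subset: "H \<subseteq> G"
  using strong unfolding strong_subgyrogroup_def subgyrogroup_def by blast

lemma strong_gyr: "\<lbrakk>x \<in> G; y \<in> G\<rbrakk> \<Longrightarrow> gyr x y ` H = H"
  using strong unfolding strong_subgyrogroup_def by blast

text \<open>The identity and inverses of \<open>H\<close> are a priori its own; left cancellation in
  \<open>G\<close> identifies them with those of \<open>G\<close>.\<close>

lemma
  shows strong_add: "\<lbrakk>h \<in> H; k \<in> H\<rbrakk> \<Longrightarrow> h \<oplus> k \<in> H"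
    and strong_zero: "zero \<in> H"
    and strong_neg: "h \<in> H \<Longrightarrow> neg h \<in> H"
proof -
  obtain zero' neg' gyr' where gg: "gyrogroup H add zero' neg' gyr'"
    using strong unfolding strong_subgyrogroup_def subgyrogroup_def by blast
  interpret S: gyrogroup H add zero' neg' gyr' by (rule gg)
  show "\<lbrakk>h \<in> H; k \<in> H\<rbrakk> \<Longrightarrow> h \<oplus> k \<in> H" by (rule S.add_closed)
  have zG: "zero' \<in> G" using S.zero_closed strong_subset by (rule subsetD[rotated])
  have z: "zero' = zero"
  proof (rule add_left_inj[OF zG zG zero_closed])
    show "zero' \<oplus> zero' = zero' \<oplus> zero"
      using S.zero_add[OF S.zero_closed] add_zero[OF zG] by simp
  qed
  then show "zero \<in> H" using S.zero_closed by simp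
  assume h: "h \<in> H"
  then have hG: "h \<in> G" and nG: "neg' h \<in> G" using S.neg_closed strong_subset by auto
  have "neg' h = neg h"
  proof (rule add_left_inj[OF hG nG neg_closed[OF hG]])
    show "h \<oplus> neg' h = h \<oplus> neg h"
      using S.add_neg[OF h] add_neg[OF hG] z by simp
  qed
  then show "neg h \<in> H" using S.neg_closed[OF h] by simp
qed

lemma mem_left_coset_self: "x \<in> G \<Longrightarrow> x \<in> left_coset add H x"
  unfolding left_coset_def using strong_zero add_zero by force

text \<open>Regrouping \<open>(a \<oplus> h) \<oplus> k\<close> costs a gyration of
  \<open>k\<close>, which the invariance of \<open>H\<close> absorbs.\<close>

lemma left_coset_add:
  assumes "a \<in> G" "h \<in> H"
  shows "left_coset add H (a \<oplus> h) = left_coset add H a"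
proof
  have hG: "h \<in> G" using assms strong_subset by blast
  show "left_coset add H (a \<oplus> h) \<subseteq> left_coset add H a"
  proof
    fix y assume "y \<in> left_coset add H (a \<oplus> h)"
    then obtain k where "k \<in> H" "y = (a \<oplus> h) \<oplus> k" unfolding left_coset_def by blast
    moreover obtain k' where "k' \<in> H" "k = gyr a h k'"
      using \<open>k \<in> H\<close> strong_gyr[OF assms(1) hG] by blast
    ultimately have "y = a \<oplus> (h \<oplus> k')"
      using assms hG strong_subset by (simp add: gyr_assoc subsetD)
    then show "y \<in> left_coset add H a"
      unfolding left_coset_def using strong_add assms \<open>k' \<in> H\<close> by blast
  qed
  show "left_coset add H a \<subseteq> left_coset add H (a \<oplus> h)"
  proof
    fix y assume "y \<in> left_coset add H a"
    then obtain k where k: "k \<in> H" "y = a \<oplus> k" unfolding left_coset_def by blast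
    have k': "neg h \<oplus> k \<in> H" using k assms strong_add strong_neg by blast
    have "y = a \<oplus> (h \<oplus> (neg h \<oplus> k))"
      using k hG strong_subset by (simp add: left_cancel' subsetD)
    also have "\<dots> = (a \<oplus> h) \<oplus> gyr a h (neg h \<oplus> k)"
      using assms hG k' strong_subset by (simp add: gyr_assoc subsetD)
    finally show "y \<in> left_coset add H (a \<oplus> h)"
      unfolding left_coset_def using k' strong_gyr[OF assms(1) hG] by blast
  qed
qed

lemma left_coset_eq_iff:
  assumes "x \<in> G" "y \<in> G"
  shows "left_coset add H x = left_coset add H y \<longleftrightarrow> (\<exists>h\<in>H. x = y \<oplus> h)"
proof
  assume "left_coset add H x = left_coset add H y"
  with mem_left_coset_self[OF assms(1)] show "\<exists>h\<in>H. x = y \<oplus> h"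
    unfolding left_coset_def by auto
next
  assume "\<exists>h\<in>H. x = y \<oplus> h"
  then show "left_coset add H x = left_coset add H y"
    using assms left_coset_add by blast
qed

end

end

section \<open>Neighbourhoods of the identity, closures and compact translates\<close>

context topological_gyrogroup
begin

lemma continuous_map_add:
  "\<lbrakk>continuous_map X T f; continuous_map X T g\<rbrakk> \<Longrightarrow> continuous_map X T (\<lambda>x. add (f x) (g x))"
  using continuous_map_compose[OF continuous_map_pairedI continuous_add, of X f g]
  by (simp add: o_def)

lemma continuous_map_neg: "continuous_map X T f \<Longrightarrow> continuous_map X T (\<lambda>x. neg (f x))"
  using continuous_map_compose[OF _ continuous_neg] by (simp add: o_def)

lemma open_nbhd_pair:
  assumes f: "continuous_map (prod_topology T T) T f"
    and "openin T N" "f (zero, zero) \<in> N"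
  obtains W where "openin T W" "zero \<in> W" "\<And>a b. \<lbrakk>a \<in> W; b \<in> W\<rbrakk> \<Longrightarrow> f (a, b) \<in> N"
proof -
  have "openin (prod_topology T T) {p \<in> topspace (prod_topology T T). f p \<in> N}"
    using f assms(2) by (rule openin_continuous_map_preimage)
  moreover have "(zero, zero) \<in> {p \<in> topspace (prod_topology T T). f p \<in> N}"
    using assms(3) zero_closed by simp
  ultimately obtain A B where AB: "openin T A" "openin T B" "zero \<in> A" "zero \<in> B"
      "A \<times> B \<subseteq> {p \<in> topspace (prod_topology T T). f p \<in> N}"
    unfolding openin_prod_topology_alt by meson
  show ?thesis
  proof (rule that[of "A \<inter> B"])
    show "openin T (A \<inter> B)" "zero \<in> A \<inter> B" using AB by auto
    show "f (a, b) \<in> N" if "a \<in> A \<inter> B" "b \<in> A \<inter> B" for a b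
      using AB(5) that by blast
  qed
qed

text \<open>The points \<open>z\<close> with \<open>neg z \<oplus> x\<close> in \<open>W\<close>
  form a neighbourhood of \<open>x\<close>, so one of them lies in \<open>W\<close>; then
  \<open>x = z \<oplus> (neg z \<oplus> x)\<close>.\<close>

lemma closure_of_subset_add:
  assumes "openin T W" "zero \<in> W" "x \<in> T closure_of W"
  shows "\<exists>a\<in>W. \<exists>b\<in>W. x = add a b"
proof -
  have x: "x \<in> topspace T" using assms(3) by (simp add: in_closure_of)
  have "continuous_map T T (\<lambda>z. add (neg z) x)"
    using x by (intro continuous_map_add continuous_map_neg) auto
  then have "openin T {z \<in> topspace T. add (neg z) x \<in> W}"
    using assms(1) by (rule openin_continuous_map_preimage)
  moreover have "x \<in> {z \<in> topspace T. add (neg z) x \<in> W}"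
    using x assms(2) by (simp add: neg_add)
  ultimately obtain z where "z \<in> W" "z \<in> {z \<in> topspace T. add (neg z) x \<in> W}"
    using assms(3) unfolding in_closure_of by meson
  then have z: "z \<in> W" "z \<in> topspace T" "add (neg z) x \<in> W" by auto
  then have "x = add z (add (neg z) x)" using x by (simp add: left_cancel')
  with z show ?thesis by blast
qed

lemma closure_of_saturation_nbhd:
  assumes H: "strong_subgyrogroup (topspace T) add gyr H"
    and W: "openin T W" "zero \<in> W"
    and F: "F \<subseteq> topspace T"
    and x: "x \<in> T closure_of {z \<in> topspace T. left_coset add H z \<in> left_coset add H ` F}"
  shows "\<exists>w\<in>W. \<exists>u\<in>F. left_coset add H x = left_coset add H (add w u)"
proof -
  \<comment> \<open>\<open>?\<phi> z\<close> is the left summand that carries \<open>z\<close> to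
    \<open>x\<close>. It vanishes at \<open>z = x\<close>, so it lies in \<open>W\<close> for some
    \<open>z\<close> of the saturation close to \<open>x\<close>.\<close>
  let ?\<phi> = "\<lambda>z. add x (add (neg (add x z)) x)"
  have xG: "x \<in> topspace T" using x by (simp add: in_closure_of)
  have "continuous_map T T ?\<phi>"
    using xG by (intro continuous_map_add continuous_map_neg) auto
  then have "openin T {z \<in> topspace T. ?\<phi> z \<in> W}"
    using W(1) by (rule openin_continuous_map_preimage)
  moreover have "x \<in> {z \<in> topspace T. ?\<phi> z \<in> W}"
    using xG W(2) by (simp add: right_cancel_self)
  ultimately obtain z where "z \<in> {z \<in> topspace T. left_coset add H z \<in> left_coset add H ` F}"
      and "z \<in> {z \<in> topspace T. ?\<phi> z \<in> W}"
    using x unfolding in_closure_of by meson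
  then obtain u where z: "z \<in> topspace T" "?\<phi> z \<in> W"
      and u: "u \<in> F" "left_coset add H z = left_coset add H u"
    by auto
  have uG: "u \<in> topspace T" and wG: "?\<phi> z \<in> topspace T"
    using u F W z openin_subset by blast+
  obtain h where h: "h \<in> H" "z = add u h"
    using left_coset_eq_iff[OF H z(1) uG] u by blast
  have hG: "h \<in> topspace T" using h strong_subset[OF H] by blast
  have "x = add (?\<phi> z) (add u h)"
    using right_cancel[OF xG z(1)] h(2) by simp
  also have "\<dots> = add (add (?\<phi> z) u) (gyr (?\<phi> z) u h)"
    using wG uG hG by (rule gyr_assoc)
  \<comment> \<open>The gyration of \<open>h\<close> stays in \<open>H\<close>, so it does not
    change the coset.\<close>
  finally have "left_coset add H x = left_coset add H (add (?\<phi> z) u)"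
    using left_coset_add[OF H] strong_gyr[OF H wG uG] h(1) wG uG add_closed by (metis imageI)
  with z u show ?thesis by blast
qed

lemma closedin_compact_translates:
  assumes F: "closedin T F" and K: "compactin T K"
  shows "closedin T {y \<in> topspace T. \<exists>k\<in>K. add y k \<in> F}"
proof -
  let ?P = "prod_topology T (subtopology T K)"
  have KG: "K \<subseteq> topspace T" using K by (rule compactin_subset_topspace)
  have "continuous_map ?P T snd"
    using continuous_map_snd[of T "subtopology T K"] continuous_map_into_fulltopology by blast
  then have "continuous_map ?P T (\<lambda>p. add (fst p) (snd p))"
    by (intro continuous_map_add continuous_map_fst)
  then have "closedin ?P {p \<in> topspace ?P. add (fst p) (snd p) \<in> F}"
    using F by (rule closedin_continuous_map_preimage)
  \<comment> \<open>Projection along the compact factor \<open>K\<close> is closed.\<close>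
  moreover have "closed_map ?P T fst"
    using K by (intro closed_map_fst compact_space_subtopology)
  ultimately have "closedin T (fst ` {p \<in> topspace ?P. add (fst p) (snd p) \<in> F})"
    unfolding closed_map_def by blast
  also have "fst ` {p \<in> topspace ?P. add (fst p) (snd p) \<in> F} =
      {y \<in> topspace T. \<exists>k\<in>K. add y k \<in> F}"
    using KG by force
  finally show ?thesis .
qed

section \<open>The projection restricted to the closure of a small neighbourhood\<close>

context
  fixes H K V N U
  assumes H: "strong_subgyrogroup (topspace T) add gyr H"
    and K: "compactin T K" "K \<subseteq> H" "V \<inter> H \<subseteq> K"
    and N: "openin T N" "\<And>a b. \<lbrakk>a \<in> N; b \<in> N\<rbrakk> \<Longrightarrow> add (neg a) b \<in> V"
    and U: "openin T U" "zero \<in> U" "\<And>a b. \<lbrakk>a \<in> U; b \<in> T closure_of U\<rbrakk> \<Longrightarrow> add a b \<in> N"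
begin

lemma closure_of_subset_nbhd: "T closure_of U \<subseteq> N"
proof
  fix x assume x: "x \<in> T closure_of U"
  then have "add zero x = x" by (simp add: in_closure_of zero_add)
  with U(3)[OF U(2) x] show "x \<in> N" by simp
qed

text \<open>\<open>h = neg y \<oplus> (y \<oplus> h)\<close> lies in \<open>V \<inter> H\<close>.
  Thus, inside \<open>N\<close>, the compact set \<open>K\<close> can replace
  \<open>H\<close>.\<close>

lemma coset_nbhd_compact:
  assumes "y \<in> N" "h \<in> H" "add y h \<in> N"
  shows "h \<in> K"
proof -
  have "y \<in> topspace T" "h \<in> topspace T"
    using assms openin_subset[OF N(1)] strong_subset[OF H] by auto
  then have "add (neg y) (add y h) = h" by (rule left_cancel)
  with N(2)[OF assms(1,3)] assms(2) K(3) show ?thesis by auto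
qed

text \<open>The saturation \<open>S\<close> agrees with the closed set \<open>D\<close> inside
  \<open>N\<close>. A closure point outside \<open>N\<close> is first moved along its coset into
  \<open>N\<close>.\<close>

lemma closedin_saturation:
  assumes F: "closedin T F" "F \<subseteq> T closure_of U"
  shows "closedin T {z \<in> topspace T. left_coset add H z \<in> left_coset add H ` F}"
proof -
  define S where "S = {z \<in> topspace T. left_coset add H z \<in> left_coset add H ` F}"
  define D where "D = {y \<in> topspace T. \<exists>k\<in>K. add y k \<in> F}"
  have FG: "F \<subseteq> topspace T" using F(1) by (rule closedin_subset)
  have D: "closedin T D"
    unfolding D_def using F(1) K(1) by (rule closedin_compact_translates)
  have "D \<subseteq> S"
  proof
    fix y assume "y \<in> D"
    then obtain k where k: "y \<in> topspace T" "k \<in> K" "add y k \<in> F" unfolding D_def by blast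
    then have "left_coset add H (add y k) = left_coset add H y"
      using left_coset_add[OF H] K(2) by blast
    with imageI[OF k(3), of "left_coset add H"] k(1) show "y \<in> S"
      unfolding S_def by simp
  qed
  have "N \<inter> S \<subseteq> D"
  proof
    fix y assume y: "y \<in> N \<inter> S"
    then obtain f where f: "f \<in> F" "left_coset add H y = left_coset add H f" and yG: "y \<in> topspace T"
      unfolding S_def by blast
    then obtain h where h: "h \<in> H" "f = add y h"
      using left_coset_eq_iff[OF H, of f y] FG by auto
    have "h \<in> K"
      using coset_nbhd_compact[of y h] y h f F(2) closure_of_subset_nbhd by blast
    with h f yG show "y \<in> D" unfolding D_def by blast
  qed
  have "T closure_of S \<subseteq> S"
  proof
    fix x assume x: "x \<in> T closure_of S"
    then have xG: "x \<in> topspace T" by (simp add: in_closure_of)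
    obtain w u where wu: "w \<in> U" "u \<in> F" "left_coset add H x = left_coset add H (add w u)"
      using closure_of_saturation_nbhd[OF H U(1,2) FG] x unfolding S_def by blast
    \<comment> \<open>\<open>a\<close> represents the coset of \<open>x\<close> and lies in
      \<open>N\<close>, where \<open>S\<close> is controlled by \<open>D\<close>.\<close>
    define a where "a = add w u"
    have aN: "a \<in> N" unfolding a_def using U(3) wu F(2) by blast
    then have aG: "a \<in> topspace T" using N(1) openin_subset by blast
    obtain h where h: "h \<in> H" "a = add x h"
      using left_coset_eq_iff[OF H aG xG] wu(3) unfolding a_def by auto
    have hG: "h \<in> topspace T" using h strong_subset[OF H] by blast
    \<comment> \<open>Right translation by \<open>h\<close> is continuous and maps \<open>S\<close>
      into itself, hence also its closure; so \<open>a = add x h\<close> is again a closure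
      point.\<close>
    have "continuous_map T T (\<lambda>z. add z h)"
      using hG by (intro continuous_map_add) auto
    then have "(\<lambda>z. add z h) ` (T closure_of S) \<subseteq> T closure_of ((\<lambda>z. add z h) ` S)"
      by (rule continuous_map_image_closure_subset)
    moreover have "(\<lambda>z. add z h) ` S \<subseteq> S"
      unfolding S_def using left_coset_add[OF H _ h(1)] add_closed hG by auto
    ultimately have "a \<in> T closure_of S"
      using x h(2) closure_of_mono by blast
    with aN have "a \<in> T closure_of (N \<inter> S)"
      using openin_Int_closure_of_subset[OF N(1)] by blast
    also have "\<dots> \<subseteq> D"
      using \<open>N \<inter> S \<subseteq> D\<close> D by (rule closure_of_minimal)
    finally have "a \<in> S" using \<open>D \<subseteq> S\<close> by blast
    then show "x \<in> S"
      using xG wu(3) unfolding S_def a_def by simp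
  qed
  moreover have "S \<subseteq> topspace T" unfolding S_def by blast
  ultimately show ?thesis
    unfolding S_def[symmetric] using closure_of_subset_eq by blast
qed

lemma closedin_left_coset_image:
  assumes "closedin T F" "F \<subseteq> T closure_of U"
  shows "closedin (coset_space T add H) (left_coset add H ` F)"
proof -
  have "left_coset add H ` F \<subseteq> topspace (coset_space T add H)"
    unfolding topspace_coset_space using closedin_subset[OF assms(1)] by (rule image_mono)
  with closedin_saturation[OF assms] show ?thesis
    using quotient_map_left_coset[of T add H] unfolding quotient_map_closedin by simp
qed

text \<open>The closure of \<open>U\<close> lies in \<open>N\<close>, so its points in the coset of
  \<open>a\<close> have the form \<open>add a k\<close> with \<open>k\<close> in \<open>K\<close>.
  The fibre is thus a closed set intersected with a compact translate.\<close>

lemma compactin_fibre: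
  assumes a: "a \<in> T closure_of U"
  shows "compactin T {x \<in> T closure_of U. left_coset add H x = left_coset add H a}"
proof -
  have aG: "a \<in> topspace T" using a by (simp add: in_closure_of)
  have "{x \<in> T closure_of U. left_coset add H x = left_coset add H a} =
      T closure_of U \<inter> add a ` K" (is "?L = ?R")
  proof
    show "?L \<subseteq> ?R"
    proof
      fix x assume x: "x \<in> ?L"
      then obtain h where h: "h \<in> H" "x = add a h"
        using left_coset_eq_iff[OF H _ aG, of x] by (auto simp: in_closure_of)
      then have "h \<in> K"
        using coset_nbhd_compact[of a h] a x closure_of_subset_nbhd by blast
      with x h show "x \<in> ?R" by blast
    qed
    show "?R \<subseteq> ?L"
      using left_coset_add[OF H aG] K(2) by auto
  qed
  moreover have "continuous_map T T (add a)"
    using continuous_map_add[of T "\<lambda>_. a" "\<lambda>x. x"] aG by simp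
  then have "compactin T (add a ` K)"
    using K(1) image_compactin by blast
  ultimately show ?thesis
    by (simp add: closed_Int_compactin)
qed

lemma perfect_map_left_coset:
  "perfect_map (subtopology T (T closure_of U))
     (subtopology (coset_space T add H) (left_coset add H ` (T closure_of U)))
     (left_coset add H)"
proof -
  let ?C = "T closure_of U"
  let ?X = "subtopology T ?C"
  let ?Y = "subtopology (coset_space T add H) (left_coset add H ` ?C)"
  have C: "?C \<subseteq> topspace T" by (rule closure_of_subset_topspace)
  have topX: "topspace ?X = ?C" using C by auto
  have topY: "topspace ?Y = left_coset add H ` ?C"
    using C by (auto simp: topspace_coset_space)
  have "continuous_map T (coset_space T add H) (left_coset add H)"
    using quotient_map_left_coset by (rule quotient_imp_continuous_map)
  then have "continuous_map ?X ?Y (left_coset add H)"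
    by (auto simp: continuous_map_in_subtopology continuous_map_from_subtopology)
  moreover have "closed_map ?X ?Y (left_coset add H)"
    unfolding closed_map_def
  proof (intro allI impI)
    fix F assume "closedin ?X F"
    then have "closedin T F" "F \<subseteq> ?C"
      by (simp_all add: closedin_closed_subtopology)
    \<comment> \<open>The image is closed in the whole coset space and contained in the image of the
      closure, hence closed in that subspace.\<close>
    then show "closedin ?Y (left_coset add H ` F)"
      by (meson closedin_left_coset_image closedin_subset_topspace image_mono)
  qed
  moreover have "compactin ?X {x \<in> topspace ?X. left_coset add H x = y}"
    if "y \<in> topspace ?Y" for y
    using that compactin_fibre unfolding topX topY by (auto simp: compactin_subtopology)
  moreover have "left_coset add H ` topspace ?X = topspace ?Y"
    unfolding topX topY ..
  ultimately show ?thesis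
    unfolding perfect_map_def proper_map_def by blast
qed

end

text \<open>Local compactness of \<open>H\<close> at \<open>zero\<close> gives \<open>K\<close> and
  \<open>V\<close>; continuity at \<open>(zero, zero)\<close> then gives \<open>N\<close>, and two
  further shrinkings \<open>M\<close> and \<open>W\<close> give the set used as
  \<open>U\<close>.\<close>

lemma locally_compact_nbhds:
  assumes H: "strong_subgyrogroup (topspace T) add gyr H"
    and "locally_compact_space (subtopology T H)"
  obtains K V N U where "compactin T K" "K \<subseteq> H" "V \<inter> H \<subseteq> K"
    "openin T N" "\<And>a b. \<lbrakk>a \<in> N; b \<in> N\<rbrakk> \<Longrightarrow> add (neg a) b \<in> V"
    "openin T U" "zero \<in> U" "\<And>a b. \<lbrakk>a \<in> U; b \<in> T closure_of U\<rbrakk> \<Longrightarrow> add a b \<in> N"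
proof -
  have "zero \<in> topspace (subtopology T H)"
    using strong_zero[OF H] zero_closed by simp
  with assms(2)[unfolded locally_compact_space_def]
  have "\<exists>V' K. openin (subtopology T H) V' \<and> compactin (subtopology T H) K \<and> zero \<in> V' \<and> V' \<subseteq> K"
    by (rule bspec)
  then obtain V' K where V': "openin (subtopology T H) V'" "zero \<in> V'" "V' \<subseteq> K"
      and "compactin (subtopology T H) K"
    by auto
  then have K: "compactin T K" "K \<subseteq> H"
    by (simp_all add: compactin_subtopology)
  obtain V where "openin T V" "V' = V \<inter> H"
    using V'(1) unfolding openin_subtopology by blast
  with V' have V: "openin T V" "zero \<in> V" "V \<inter> H \<subseteq> K" by simp_all
  have fst: "continuous_map (prod_topology T T) T fst"
    and snd: "continuous_map (prod_topology T T) T snd"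
    by (rule continuous_map_fst continuous_map_snd)+
  have "continuous_map (prod_topology T T) T (\<lambda>p. add (neg (fst p)) (snd p))"
    by (intro continuous_map_add continuous_map_neg fst snd)
  then obtain N where N: "openin T N" "zero \<in> N"
      "\<And>a b. \<lbrakk>a \<in> N; b \<in> N\<rbrakk> \<Longrightarrow> add (neg a) b \<in> V"
    using open_nbhd_pair[of "\<lambda>p. add (neg (fst p)) (snd p)" V] V zero_closed
    by (auto simp: neg_add)
  have "continuous_map (prod_topology T T) T (\<lambda>p. add (fst p) (snd p))"
    by (intro continuous_map_add fst snd)
  note pair = open_nbhd_pair[OF this]
  obtain M where M: "openin T M" "zero \<in> M" "\<And>a b. \<lbrakk>a \<in> M; b \<in> M\<rbrakk> \<Longrightarrow> add a b \<in> N"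
    using pair[of N] N zero_closed by (auto simp: zero_add)
  obtain W where W: "openin T W" "zero \<in> W" "\<And>a b. \<lbrakk>a \<in> W; b \<in> W\<rbrakk> \<Longrightarrow> add a b \<in> M"
    using pair[of M] M zero_closed by (auto simp: zero_add)
  \<comment> \<open>Each \<open>a\<close> in \<open>W\<close> equals \<open>add zero a\<close> with
    \<open>zero\<close> in \<open>W\<close>.\<close>
  have "W \<subseteq> M"
  proof
    fix a assume "a \<in> W"
    then show "a \<in> M"
      using W(3)[OF W(2)] zero_add openin_subset[OF W(1)] by (metis subsetD)
  qed
  \<comment> \<open>A closure point \<open>b\<close> of \<open>W\<close> is a sum of two elements of
    \<open>W\<close>, hence in \<open>M\<close>; \<open>a\<close> is in \<open>M\<close> too, so
    their sum is in \<open>N\<close>.\<close>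
  have "add a b \<in> N" if ab: "a \<in> W" "b \<in> T closure_of W" for a b
  proof -
    obtain c d where "c \<in> W" "d \<in> W" "b = add c d"
      using closure_of_subset_add[OF W(1,2) ab(2)] by blast
    with ab(1) \<open>W \<subseteq> M\<close> show ?thesis
      by (simp add: M(3) W(3) subsetD)
  qed
  with K V(3) N(1,3) W(1,2) show ?thesis by (rule that)
qed

end

theorem theorem4p5:
  fixes T :: "'a topology"
    and add :: "'a \<Rightarrow> 'a \<Rightarrow> 'a"
    and zero :: 'a
    and neg :: "'a \<Rightarrow> 'a"
    and gyr :: "'a \<Rightarrow> 'a \<Rightarrow> 'a \<Rightarrow> 'a"
    and H :: "'a set"
  assumes "Hausdorff_space T"
    and "strongly_topological_gyrogroup T add zero neg gyr"
    and "strong_subgyrogroup (topspace T) add gyr H"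
    and "locally_compact_space (subtopology T H)"
  shows "\<exists>U. openin T U \<and> zero \<in> U \<and>
           closedin (coset_space T add H) (left_coset add H ` (T closure_of U)) \<and>
           perfect_map
             (subtopology T (T closure_of U))
             (subtopology (coset_space T add H) (left_coset add H ` (T closure_of U)))
             (left_coset add H)"
proof -
  interpret strongly_topological_gyrogroup T add zero neg gyr by (rule assms(2))
  obtain K V N U where nbhds: "compactin T K" "K \<subseteq> H" "V \<inter> H \<subseteq> K"
      "openin T N" "\<And>a b. \<lbrakk>a \<in> N; b \<in> N\<rbrakk> \<Longrightarrow> add (neg a) b \<in> V"
      "openin T U" "zero \<in> U" "\<And>a b. \<lbrakk>a \<in> U; b \<in> T closure_of U\<rbrakk> \<Longrightarrow> add a b \<in> N"
    by (rule locally_compact_nbhds[OF assms(3,4)]) (rule that)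
  show ?thesis
  proof (intro exI conjI)
    show "openin T U" "zero \<in> U" by (rule nbhds)+
    show "closedin (coset_space T add H) (left_coset add H ` (T closure_of U))"
      using assms(3) nbhds closedin_closure_of subset_refl by (rule closedin_left_coset_image)
    show "perfect_map (subtopology T (T closure_of U))
        (subtopology (coset_space T add H) (left_coset add H ` (T closure_of U)))
        (left_coset add H)"
      using assms(3) nbhds by (rule perfect_map_left_coset)
  qed
qed

end
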